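(* Let $X$ be a real random variable and let $F,U:\mathbb{R}\to\mathbb{R}$ satisfy $E[e^{\theta F(X)}]<\infty$ and $E[e^{\theta U(X)}]<\infty$ for all $\theta\in\mathbb{R}$. Suppose that $E[F(X)]=E[U(X)]=0$, $\mathrm{Var}(F(X))=\mathrm{Var}(U(X))=1$, and that $\gamma:=\mathrm{Cov}(F(X),U(X))$ is nonzero. For $\varepsilon,u>0$ let $$\Delta(\varepsilon,u):=\max\{\Lambda_+^*(\varepsilon,u),\Gamma_+^*(\varepsilon,u)\}-\Lambda^*(\varepsilon),$$ with $\Lambda_+^*$, $\Gamma_+^*$, $\Lambda^*$ as defined in the context. Then there exists $\alpha>0$ such that $$\liminf_{\varepsilon\to0}\frac1{\varepsilon^2}\Delta(\varepsilon,\alpha\varepsilon)>0,$$ where the limit is over $\varepsilon>0$. In fact, there exists $\varepsilon_0>0$ such that $$\Delta\left(\varepsilon,\frac{|\gamma|}4\varepsilon\right)\ge\frac{\gamma^2}8\varepsilon^2$$ for all $\varepsilon\in(0,\varepsilon_0)$.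
   Context: Functions are Borel measurable. For $\varepsilon,u>0$ (with $E[F(X)]=E[U(X)]=0$), define $$\Lambda^*(\varepsilon):=\sup_{\theta\ge0}\{\theta\varepsilon-\Lambda(\theta)\},\qquad \Lambda(\theta):=\log E[e^{\theta F(X)}],$$ $$\Lambda_+^*(\varepsilon,u):=\sup_{\theta_1\ge0,\theta_2\ge0}\{\theta_1\varepsilon-\theta_2u-\log E[\exp\{\theta_1F(X)-\theta_2U(X)\}]\},$$ $$\Gamma_+^*(\varepsilon,u):=\sup_{\theta_1\ge0,\theta_2\ge0}\{\theta_1\varepsilon-\theta_2u-\log E[\exp\{\theta_1F(X)+\theta_2U(X)\}]\}.$$ Here $\Lambda^*(\varepsilon)$ is the large deviations exponent of $\Pr\{\sum_{i\le n}F(X_i)>n\varepsilon\}$ for i.i.d. copies $X_i$ of $X$, and $\max\{\Lambda_+^*,\Gamma_+^*\}$ is the exponent in the exponential upper bound for $\Pr\{\sum_{i\le n}F(X_i)>n\varepsilon,\ |\sum_{i\le n}U(X_i)|<nu\}$. *)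

theory Defs
  imports "HOL-Probability.Probability"
begin

definition covariance :: "'a measure \<Rightarrow> ('a \<Rightarrow> real) \<Rightarrow> ('a \<Rightarrow> real) \<Rightarrow> real" where
  "covariance M Y Z =
     prob_space.expectation M (\<lambda>\<omega>.
       (Y \<omega> - prob_space.expectation M Y) * (Z \<omega> - prob_space.expectation M Z))"

definition log_mgf :: "'a measure \<Rightarrow> ('a \<Rightarrow> real) \<Rightarrow> (real \<Rightarrow> real) \<Rightarrow> real \<Rightarrow> real" where
  "log_mgf M X F \<theta> = ln (prob_space.expectation M (\<lambda>\<omega>. exp (\<theta> * F (X \<omega>))))"

text \<open>The exponents are suprema in the extended reals, since they can be infinite: for instance,
  if \<open>F = U\<close> and \<open>u < \<epsilon>\<close>, then \<open>\<Lambda>\<^sub>+\<^sup>*(\<epsilon>, u) = \<infinity>\<close> (take \<open>\<theta>\<^sub>1 = \<theta>\<^sub>2 \<rightarrow> \<infinity>\<close>).\<close>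

definition Lambda_star :: "'a measure \<Rightarrow> ('a \<Rightarrow> real) \<Rightarrow> (real \<Rightarrow> real) \<Rightarrow> real \<Rightarrow> ereal" where
  "Lambda_star M X F \<epsilon> = (SUP \<theta>\<in>{0..}. ereal (\<theta> * \<epsilon> - log_mgf M X F \<theta>))"

definition Lambda_plus_star ::
  "'a measure \<Rightarrow> ('a \<Rightarrow> real) \<Rightarrow> (real \<Rightarrow> real) \<Rightarrow> (real \<Rightarrow> real) \<Rightarrow> real \<Rightarrow> real \<Rightarrow> ereal" where
  "Lambda_plus_star M X F U \<epsilon> u =
     (SUP (\<theta>\<^sub>1, \<theta>\<^sub>2)\<in>{0..} \<times> {0..}.
        ereal (\<theta>\<^sub>1 * \<epsilon> - \<theta>\<^sub>2 * u
          - ln (prob_space.expectation M (\<lambda>\<omega>. exp (\<theta>\<^sub>1 * F (X \<omega>) - \<theta>\<^sub>2 * U (X \<omega>))))))"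

definition Gamma_plus_star ::
  "'a measure \<Rightarrow> ('a \<Rightarrow> real) \<Rightarrow> (real \<Rightarrow> real) \<Rightarrow> (real \<Rightarrow> real) \<Rightarrow> real \<Rightarrow> real \<Rightarrow> ereal" where
  "Gamma_plus_star M X F U \<epsilon> u =
     (SUP (\<theta>\<^sub>1, \<theta>\<^sub>2)\<in>{0..} \<times> {0..}.
        ereal (\<theta>\<^sub>1 * \<epsilon> - \<theta>\<^sub>2 * u
          - ln (prob_space.expectation M (\<lambda>\<omega>. exp (\<theta>\<^sub>1 * F (X \<omega>) + \<theta>\<^sub>2 * U (X \<omega>))))))"

text \<open>If \<open>\<Lambda>\<^sup>*(\<epsilon>) = \<infinity>\<close>, the following is the form \<open>\<infinity> - \<infinity>\<close>, to which \<open>ereal\<close> assigns the value \<open>\<infinity>\<close>.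
  When \<open>F(X)\<close> has mean 0 and variance 1, \<open>\<Lambda>\<^sup>*(\<epsilon>)\<close> is finite for all sufficiently small
  \<open>\<epsilon> > 0\<close>, so this convention does not affect statements about \<open>\<epsilon> \<rightarrow> 0\<close>.\<close>

definition Delta ::
  "'a measure \<Rightarrow> ('a \<Rightarrow> real) \<Rightarrow> (real \<Rightarrow> real) \<Rightarrow> (real \<Rightarrow> real) \<Rightarrow> real \<Rightarrow> real \<Rightarrow> ereal" where
  "Delta M X F U \<epsilon> u =
     max (Lambda_plus_star M X F U \<epsilon> u) (Gamma_plus_star M X F U \<epsilon> u) - Lambda_star M X F \<epsilon>"

end

(*
  Take theta1 = eps and theta2 = |gamma| eps in Lambda_plus_star if gamma > 0 and in
  Gamma_plus_star if gamma < 0.  In both cases the exponent is eps (F - gamma U), whose second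
  moment is eps^2 (1 - gamma^2), so the maximum of the two exponents is at least
  (1/2 + gamma^2/4) eps^2 - O(eps^3) for u = |gamma| eps / 4.  On the other side, the logarithmic
  moment generating function of F exceeds c theta^2 / 2 near 0 for every c < 1, and by convexity
  it grows at least linearly further out, whence Lambda_star is at most eps^2 / (2 c) for small
  eps.  With 1 / c = 1 + gamma^2 / 8 this leaves gamma^2 eps^2 / 8.
*)

theory Submission
  imports Defs
begin

section \<open>Elementary inequalities for the exponential function\<close>

text \<open>A single term of the series of \<open>exp \<bar>x\<bar>\<close> is at most the whole,
  and \<open>exp \<bar>x\<bar>\<close> is one of the two summands on the right. This form lets
  exponential moments of both signs dominate all powers.\<close>

lemma abs_power_le_exp:
  fixes x :: real
  shows "\<bar>x\<bar> ^ n \<le> fact n * (exp x + exp (- x))"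
proof -
  obtain t where t: "exp \<bar>x\<bar> = (\<Sum>m<Suc n. \<bar>x\<bar> ^ m / fact m) + exp t / fact (Suc n) * \<bar>x\<bar> ^ Suc n"
    using Maclaurin_exp_le[of "\<bar>x\<bar>" "Suc n"] by auto
  have "\<bar>x\<bar> ^ n / fact n \<le> (\<Sum>m<Suc n. \<bar>x\<bar> ^ m / fact m)"
    by (simp add: sum_nonneg)
  also have "\<dots> \<le> exp \<bar>x\<bar>"
    unfolding t by simp
  also have "\<dots> \<le> exp x + exp (- x)"
    by (cases "x \<ge> 0") auto
  finally show ?thesis
    by (simp add: field_simps)
qed

text \<open>Taylor's formula with Lagrange remainder; the factor 1/6 is given away.\<close>

lemma exp_quadratic_remainder:
  fixes x :: real
  shows "\<bar>exp x - (1 + x + x\<^sup>2 / 2)\<bar> \<le> \<bar>x\<bar> ^ 3 * exp \<bar>x\<bar>"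
proof -
  obtain t where t: "\<bar>t\<bar> \<le> \<bar>x\<bar>" "exp x = (\<Sum>m<3. x ^ m / fact m) + exp t / fact 3 * x ^ 3"
    using Maclaurin_exp_le[of x 3] by auto
  have "exp x - (1 + x + x\<^sup>2 / 2) = exp t / 6 * x ^ 3"
    using t(2) by (simp add: numeral_3_eq_3 fact_numeral power2_eq_square)
  hence "\<bar>exp x - (1 + x + x\<^sup>2 / 2)\<bar> = \<bar>exp t / 6 * x ^ 3\<bar>"
    by (rule arg_cong)
  also have "\<dots> = exp t / 6 * \<bar>x\<bar> ^ 3"
    by (simp add: abs_mult power_abs)
  also have "\<dots> \<le> exp \<bar>x\<bar> * \<bar>x\<bar> ^ 3"
  proof (rule mult_right_mono)
    have "exp t \<le> exp \<bar>x\<bar>"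
      using t(1) by simp
    thus "exp t / 6 \<le> exp \<bar>x\<bar>"
      using exp_gt_zero[of t] by linarith
  qed simp
  finally show ?thesis
    by (simp add: mult.commute)
qed

text \<open>With \<open>v = exp y\<close> this is the tangent at \<open>v = 1\<close> to the convex
  function \<open>v\<close> to the power \<open>p\<close>. It follows from
  \<open>exp z \<ge> 1 + z\<close> at \<open>z = (p - 1) * y\<close> and at
  \<open>z = - y\<close>.\<close>

lemma exp_mult_ge_tangent:
  fixes p y :: real
  assumes "p \<ge> 1"
  shows "1 + p * (exp y - 1) \<le> exp (p * y)"
proof -
  have "exp y * (1 + (p - 1) * y) \<le> exp y * exp ((p - 1) * y)"
    by (intro mult_left_mono) auto
  also have "\<dots> = exp (p * y)"
    by (simp add: exp_add[symmetric] algebra_simps)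
  finally have 1: "exp y * (1 + (p - 1) * y) \<le> exp (p * y)" .
  have "exp y * (1 - y) \<le> exp y * exp (- y)"
    using exp_ge_add_one_self[of "- y"] by (intro mult_left_mono) auto
  hence "(p - 1) * (exp y * (1 - y)) \<le> (p - 1) * 1"
    using assms by (intro mult_left_mono) (auto simp: exp_minus)
  with 1 show ?thesis
    by (simp add: algebra_simps)
qed

section \<open>Integrability and expansion of moment generating functions\<close>

context prob_space
begin

text \<open>The product of \<open>exp (Y x)\<close> and \<open>exp (Z x)\<close> is dominated by the
  sum of their squares. This gives a linear combination of \<open>F\<close> and \<open>U\<close>
  exponential moments of all orders without any assumption on their joint law.\<close>

lemma integrable_exp_add:
  fixes Y Z :: "'a \<Rightarrow> real"
  assumes [measurable]: "Y \<in> borel_measurable M" "Z \<in> borel_measurable M"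
    and Y: "integrable M (\<lambda>x. exp (2 * Y x))" and Z: "integrable M (\<lambda>x. exp (2 * Z x))"
  shows "integrable M (\<lambda>x. exp (Y x + Z x))"
proof (rule Bochner_Integration.integrable_bound[OF Bochner_Integration.integrable_add[OF Y Z]])
  show "AE x in M. norm (exp (Y x + Z x)) \<le> norm (exp (2 * Y x) + exp (2 * Z x))"
  proof (intro AE_I2)
    fix x
    have "2 * (exp (Y x) * exp (Z x)) \<le> (exp (Y x))\<^sup>2 + (exp (Z x))\<^sup>2"
      using sum_squares_bound[of "exp (Y x)" "exp (Z x)"] by simp
    moreover have "0 \<le> exp (Y x) * exp (Z x)"
      by simp
    ultimately have "exp (Y x + Z x) \<le> exp (2 * Y x) + exp (2 * Z x)"
      unfolding exp_add exp_double by linarith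
    thus "norm (exp (Y x + Z x)) \<le> norm (exp (2 * Y x) + exp (2 * Z x))"
      by simp
  qed
qed simp

lemma integrable_power_of_mgf:
  fixes G :: "'a \<Rightarrow> real"
  assumes [measurable]: "G \<in> borel_measurable M" and int: "\<And>t. integrable M (\<lambda>x. exp (t * G x))"
  shows "integrable M (\<lambda>x. G x ^ n)"
proof (rule Bochner_Integration.integrable_bound)
  show "integrable M (\<lambda>x. fact n * (exp (1 * G x) + exp ((-1) * G x)))"
    by (intro integrable_mult_right Bochner_Integration.integrable_add int)
  show "AE x in M. norm (G x ^ n) \<le> norm (fact n * (exp (1 * G x) + exp ((-1) * G x)))"
    using abs_power_le_exp[of _ n] by (intro AE_I2) (simp add: power_abs abs_mult)
qed simp

text \<open>The pointwise Taylor remainder at \<open>t * G x\<close> is integrated. For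
  \<open>\<bar>t\<bar> \<le> 1\<close> it is at most \<open>\<bar>t\<bar> ^ 3\<close> times an
  integrable function independent of \<open>t\<close>, whose expectation serves as
  \<open>C\<close>.\<close>

lemma mgf_quadratic_expansion:
  fixes G :: "'a \<Rightarrow> real"
  assumes [measurable]: "G \<in> borel_measurable M" and int: "\<And>t. integrable M (\<lambda>x. exp (t * G x))"
  obtains C where "C \<ge> 0"
    and "\<And>t. \<bar>t\<bar> \<le> 1 \<Longrightarrow> \<bar>expectation (\<lambda>x. exp (t * G x))
           - (1 + t * expectation G + t\<^sup>2 / 2 * expectation (\<lambda>x. (G x)\<^sup>2))\<bar> \<le> C * \<bar>t\<bar> ^ 3"
proof
  \<comment> \<open>\<open>H\<close> dominates
    \<open>\<bar>G x\<bar> ^ 3 * exp \<bar>G x\<bar>\<close>: the cube is at most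
    \<open>fact 3 = 6\<close> times \<open>exp (G x) + exp (- G x)\<close>, and multiplying by
    \<open>exp \<bar>G x\<bar>\<close> gives \<open>exp (2 * G x) + 1\<close> or
    \<open>1 + exp (- 2 * G x)\<close>, according to the sign of \<open>G x\<close>.\<close>
  define H where "H = (\<lambda>x. 6 * (exp (2 * G x) + 1 + exp ((-2) * G x) + 1))"
  have H: "integrable M H"
    unfolding H_def
    by (intro integrable_mult_right Bochner_Integration.integrable_add int) auto
  have H0: "H x \<ge> 0" for x
    by (simp add: H_def)
  show "expectation H \<ge> 0"
    by (simp add: H0)
  have H_bound: "\<bar>G x\<bar> ^ 3 * exp \<bar>G x\<bar> \<le> H x" for x
  proof -
    have "(exp (G x) + exp (- G x)) * exp \<bar>G x\<bar> \<le> exp (2 * G x) + 1 + exp ((-2) * G x) + 1"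
      using exp_ge_zero[of "2 * G x"] exp_ge_zero[of "(-2) * G x"]
      by (cases "G x \<ge> 0") (simp_all add: distrib_right flip: exp_add)
    hence "6 * ((exp (G x) + exp (- G x)) * exp \<bar>G x\<bar>) \<le> H x"
      unfolding H_def by (rule mult_left_mono) simp
    moreover have "fact 3 = (6 :: real)"
      by (simp add: fact_numeral)
    hence "\<bar>G x\<bar> ^ 3 * exp \<bar>G x\<bar> \<le> 6 * ((exp (G x) + exp (- G x)) * exp \<bar>G x\<bar>)"
      using mult_right_mono[OF abs_power_le_exp[of "G x" 3], of "exp \<bar>G x\<bar>"]
      by (simp only: exp_ge_zero mult.assoc)
    ultimately show ?thesis
      by (rule order_trans[rotated])
  qed
  fix t :: real assume t: "\<bar>t\<bar> \<le> 1"
  have G1: "integrable M G" and G2: "integrable M (\<lambda>x. (G x)\<^sup>2)"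
    using integrable_power_of_mgf[OF assms, of 1] integrable_power_of_mgf[OF assms, of 2] by auto
  let ?R = "\<lambda>x. exp (t * G x) - (1 + t * G x + t\<^sup>2 / 2 * (G x)\<^sup>2)"
  have R: "integrable M ?R"
    using int[of t] G1 G2 by auto
  have "expectation ?R = expectation (\<lambda>x. exp (t * G x))
           - (1 + t * expectation G + t\<^sup>2 / 2 * expectation (\<lambda>x. (G x)\<^sup>2))"
    using int[of t] G1 G2 by (simp add: prob_space)
  moreover have "\<bar>expectation ?R\<bar> \<le> expectation (\<lambda>x. \<bar>?R x\<bar>)"
    by (rule integral_abs_bound)
  moreover have "expectation (\<lambda>x. \<bar>?R x\<bar>) \<le> expectation (\<lambda>x. \<bar>t\<bar> ^ 3 * H x)"
  proof (rule integral_mono)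
    fix x
    have "\<bar>?R x\<bar> \<le> \<bar>t * G x\<bar> ^ 3 * exp \<bar>t * G x\<bar>"
      using exp_quadratic_remainder[of "t * G x"] by (simp add: power_mult_distrib)
    \<comment> \<open>Only the exponent is enlarged, so that the cubic order in \<open>t\<close>
      survives.\<close>
    also have "\<dots> \<le> \<bar>t * G x\<bar> ^ 3 * exp \<bar>G x\<bar>"
      using t by (intro mult_left_mono) (auto simp: abs_mult mult_left_le_one_le)
    also have "\<dots> = \<bar>t\<bar> ^ 3 * (\<bar>G x\<bar> ^ 3 * exp \<bar>G x\<bar>)"
      by (simp add: abs_mult power_mult_distrib)
    also have "\<dots> \<le> \<bar>t\<bar> ^ 3 * H x"
      by (intro mult_left_mono H_bound) auto
    finally show "\<bar>?R x\<bar> \<le> \<bar>t\<bar> ^ 3 * H x" .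
  qed (use R H in auto)
  ultimately show "\<bar>expectation (\<lambda>x. exp (t * G x))
      - (1 + t * expectation G + t\<^sup>2 / 2 * expectation (\<lambda>x. (G x)\<^sup>2))\<bar> \<le> expectation H * \<bar>t\<bar> ^ 3"
    by (simp add: mult.commute)
qed

text \<open>A vanishing integral would make the positive integrand zero almost everywhere, which a
  probability measure excludes. Positivity is what the rules for \<open>ln\<close> require
  below.\<close>

lemma expectation_exp_pos:
  fixes G :: "'a \<Rightarrow> real"
  assumes "integrable M (\<lambda>x. exp (G x))"
  shows "expectation (\<lambda>x. exp (G x)) > 0"
proof -
  have "expectation (\<lambda>x. exp (G x)) \<noteq> 0"
  proof
    assume "expectation (\<lambda>x. exp (G x)) = 0"
    hence "AE x in M. exp (G x) = 0"
      by (subst (asm) integral_nonneg_eq_0_iff_AE[OF assms]) auto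
    thus False
      using AE_False by auto
  qed
  thus ?thesis
    by (simp add: order_less_le)
qed

section \<open>Bounds on the logarithmic moment generating function and its Legendre
  transform\<close>

text \<open>This is Lyapunov's inequality in logarithmic form: a convex function that vanishes at 0
  has nondecreasing slopes from the origin. It carries a bound at one point \<open>s\<close> to all
  larger \<open>t\<close>.\<close>

lemma log_mgf_star_shaped:
  fixes G :: "'a \<Rightarrow> real"
  assumes int: "\<And>t. integrable M (\<lambda>x. exp (t * G x))" and s: "0 < s" "s \<le> t"
  shows "t / s * ln (expectation (\<lambda>x. exp (s * G x))) \<le> ln (expectation (\<lambda>x. exp (t * G x)))"
proof -
  define m p where "m = ln (expectation (\<lambda>x. exp (s * G x)))" and "p = t / s"
  have p: "p \<ge> 1" and ps: "p * s = t"
    using s by (auto simp: p_def)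
  have em: "exp m = expectation (\<lambda>x. exp (s * G x))"
    unfolding m_def using expectation_exp_pos[OF int] by simp
  \<comment> \<open>Jensen's inequality by hand: the tangent bound is integrated at
    \<open>y = s * G x - m\<close>. Since \<open>exp y\<close> has expectation 1, the linear term
    integrates to 0 and the left side is 1.\<close>
  have "1 + p * (exp (- m) * expectation (\<lambda>x. exp (s * G x)) - 1)
      = expectation (\<lambda>x. 1 + p * (exp (- m) * exp (s * G x) - 1))"
    using int[of s] by (simp add: prob_space)
  also have "\<dots> \<le> expectation (\<lambda>x. exp (- (p * m)) * exp (t * G x))"
  proof (rule integral_mono)
    fix x
    show "1 + p * (exp (- m) * exp (s * G x) - 1) \<le> exp (- (p * m)) * exp (t * G x)"
      using exp_mult_ge_tangent[OF p, of "s * G x - m"] ps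
      by (simp add: exp_add[symmetric] algebra_simps flip: mult.assoc)
  qed (use int in auto)
  finally have "1 \<le> exp (- (p * m)) * expectation (\<lambda>x. exp (t * G x))"
    by (simp add: em[symmetric] exp_minus)
  hence "exp (p * m) \<le> expectation (\<lambda>x. exp (t * G x))"
    by (simp add: exp_minus field_simps)
  thus ?thesis
    using expectation_exp_pos[OF int] by (simp add: ln_ge_iff p_def m_def)
qed

text \<open>The moment generating function is at least \<open>1 + t\<^sup>2 / 2 - C * t ^ 3\<close>,
  so any factor \<open>c < 1\<close> leaves room for cubic errors near 0. Comparing with
  \<open>exp (c * t\<^sup>2 / 2)\<close> avoids expanding \<open>ln\<close>.\<close>

lemma log_mgf_quadratic_lower_bound:
  fixes G :: "'a \<Rightarrow> real"
  assumes [measurable]: "G \<in> borel_measurable M" and int: "\<And>t. integrable M (\<lambda>x. exp (t * G x))"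
    and mean: "expectation G = 0" and var: "expectation (\<lambda>x. (G x)\<^sup>2) = 1"
    and c: "0 < c" "c < 1"
  obtains r where "r > 0"
    and "\<And>t. 0 \<le> t \<Longrightarrow> t \<le> r \<Longrightarrow> c * t\<^sup>2 / 2 \<le> ln (expectation (\<lambda>x. exp (t * G x)))"
proof -
  obtain C where C: "C \<ge> 0"
    and expansion: "\<And>t. \<bar>t\<bar> \<le> 1 \<Longrightarrow> \<bar>expectation (\<lambda>x. exp (t * G x))
           - (1 + t * expectation G + t\<^sup>2 / 2 * expectation (\<lambda>x. (G x)\<^sup>2))\<bar> \<le> C * \<bar>t\<bar> ^ 3"
    using mgf_quadratic_expansion[OF assms(1) int] by blast
  \<comment> \<open>The gap \<open>(1 - c) / 2 * t\<^sup>2\<close> has to absorb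
    \<open>C * t ^ 3\<close> from the expansion and one further \<open>t ^ 3\<close> from the square
    of \<open>?z\<close> in the bound on \<open>exp ?z\<close>; hence \<open>C + 1\<close>.\<close>
  define r where "r = (1 - c) / (2 * (C + 1))"
  have r: "r > 0" "r \<le> 1" "(C + 1) * r = (1 - c) / 2"
    using C c by (auto simp: r_def field_simps)
  have "c * t\<^sup>2 / 2 \<le> ln (expectation (\<lambda>x. exp (t * G x)))" if t: "0 \<le> t" "t \<le> r" for t
  proof -
    let ?z = "c * t\<^sup>2 / 2"
    have t1: "t \<le> 1" and t2: "t\<^sup>2 \<le> 1"
      using t r by (auto simp: power_le_one)
    have ct: "c * t\<^sup>2 \<le> 1 * t\<^sup>2"
      using c by (intro mult_right_mono) auto
    have z: "0 \<le> ?z" "?z \<le> 1"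
      using c t2 ct by auto
    have "?z\<^sup>2 \<le> (t\<^sup>2 / 2)\<^sup>2"
      using z ct by (intro power_mono) auto
    also have "\<dots> = t ^ 3 * t / 4"
      by (simp add: power2_eq_square power3_eq_cube)
    also have "\<dots> \<le> t ^ 3"
      using mult_left_mono[of t 1 "t ^ 3"] t t1 zero_le_power[of t 3] by linarith
    finally have z2: "?z\<^sup>2 \<le> t ^ 3" .
    have "(C + 1) * t ^ 3 = ((C + 1) * t) * t\<^sup>2"
      by (simp add: power2_eq_square power3_eq_cube)
    also have "\<dots> \<le> ((C + 1) * r) * t\<^sup>2"
      using C t by (intro mult_right_mono mult_left_mono) auto
    also have "\<dots> = (1 - c) / 2 * t\<^sup>2"
      by (simp add: r(3))
    finally have Ct: "(C + 1) * t ^ 3 \<le> (1 - c) / 2 * t\<^sup>2" .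
    have "exp ?z \<le> 1 + ?z + ?z\<^sup>2"
      by (rule exp_bound[OF z])
    also have "\<dots> \<le> 1 + t\<^sup>2 / 2 - C * t ^ 3"
      using z2 Ct by (simp add: algebra_simps)
    also have "\<dots> \<le> expectation (\<lambda>x. exp (t * G x))"
      using expansion[of t] t t1 by (simp add: mean var abs_le_iff)
    finally show ?thesis
      using expectation_exp_pos[OF int] by (subst ln_ge_iff) auto
  qed
  with r that show ?thesis
    by blast
qed

text \<open>For \<open>t \<le> r\<close> the quadratic lower bound and completing the square
  suffice. For \<open>t > r\<close> the logarithm grows at least linearly, with slope
  \<open>c * r / 2\<close>, so for smaller \<open>\<epsilon>\<close> the left side is at most
  0.\<close>

lemma legendre_quadratic_upper_bound:
  fixes G :: "'a \<Rightarrow> real"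
  assumes [measurable]: "G \<in> borel_measurable M" and int: "\<And>t. integrable M (\<lambda>x. exp (t * G x))"
    and mean: "expectation G = 0" and var: "expectation (\<lambda>x. (G x)\<^sup>2) = 1"
    and c: "0 < c" "c < 1"
  obtains e where "e > 0"
    and "\<And>\<epsilon> t. 0 < \<epsilon> \<Longrightarrow> \<epsilon> < e \<Longrightarrow> 0 \<le> t \<Longrightarrow>
           t * \<epsilon> - ln (expectation (\<lambda>x. exp (t * G x))) \<le> \<epsilon>\<^sup>2 / (2 * c)"
proof -
  obtain r where r: "r > 0"
    and lower: "\<And>t. 0 \<le> t \<Longrightarrow> t \<le> r \<Longrightarrow> c * t\<^sup>2 / 2 \<le> ln (expectation (\<lambda>x. exp (t * G x)))"
    using log_mgf_quadratic_lower_bound[OF assms] by blast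
  have "t * \<epsilon> - ln (expectation (\<lambda>x. exp (t * G x))) \<le> \<epsilon>\<^sup>2 / (2 * c)"
    \<comment> \<open>The threshold is the slope of the chord of \<open>c * t\<^sup>2 / 2\<close>
      over the interval from 0 to \<open>r\<close>.\<close>
    if \<epsilon>: "0 < \<epsilon>" "\<epsilon> < c * r / 2" and t: "0 \<le> t" for \<epsilon> t
  proof (cases "t \<le> r")
    case True
    have "0 \<le> (\<epsilon> - c * t)\<^sup>2 / (2 * c)"
      using c by simp
    also have "\<dots> = \<epsilon>\<^sup>2 / (2 * c) - t * \<epsilon> + c * t\<^sup>2 / 2"
      using c by (simp add: power2_eq_square field_simps)
    finally show ?thesis
      using lower[OF t True] by simp
  next
    case False
    have "t * \<epsilon> \<le> t * (c * r / 2)"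
      using \<epsilon> t by (intro mult_left_mono) auto
    also have "\<dots> = t / r * (c * r\<^sup>2 / 2)"
      using r by (simp add: power2_eq_square)
    also have "\<dots> \<le> t / r * ln (expectation (\<lambda>x. exp (r * G x)))"
      using lower[of r] r t by (intro mult_left_mono) auto
    also have "\<dots> \<le> ln (expectation (\<lambda>x. exp (t * G x)))"
      using log_mgf_star_shaped[OF int r] False by simp
    finally show ?thesis
      using c by (smt (verit) divide_nonneg_pos zero_le_power2)
  qed
  moreover have "c * r / 2 > 0"
    using c r by simp
  ultimately show ?thesis
    using that by blast
qed

text \<open>By \<open>ln y \<le> y - 1\<close> the expansion bounds the logarithm directly, its
  linear term being 0. The second moment stays general because the lemma is applied to
  \<open>F - \<gamma> U\<close>, whose variance is below 1.\<close>

lemma log_mgf_quadratic_upper_bound: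
  fixes G :: "'a \<Rightarrow> real"
  assumes [measurable]: "G \<in> borel_measurable M" and int: "\<And>t. integrable M (\<lambda>x. exp (t * G x))"
    and mean: "expectation G = 0"
  obtains C where "C \<ge> 0"
    and "\<And>t. 0 \<le> t \<Longrightarrow> t \<le> 1 \<Longrightarrow>
           ln (expectation (\<lambda>x. exp (t * G x))) \<le> t\<^sup>2 / 2 * expectation (\<lambda>x. (G x)\<^sup>2) + C * t ^ 3"
proof -
  obtain C where C: "C \<ge> 0"
    and bound: "\<And>t. \<bar>t\<bar> \<le> 1 \<Longrightarrow> \<bar>expectation (\<lambda>x. exp (t * G x))
           - (1 + t * expectation G + t\<^sup>2 / 2 * expectation (\<lambda>x. (G x)\<^sup>2))\<bar> \<le> C * \<bar>t\<bar> ^ 3"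
    using mgf_quadratic_expansion[OF assms(1) int] by blast
  have "ln (expectation (\<lambda>x. exp (t * G x))) \<le> t\<^sup>2 / 2 * expectation (\<lambda>x. (G x)\<^sup>2) + C * t ^ 3"
    if t: "0 \<le> t" "t \<le> 1" for t
  proof -
    have "ln (expectation (\<lambda>x. exp (t * G x))) \<le> expectation (\<lambda>x. exp (t * G x)) - 1"
      using expectation_exp_pos[OF int] by (rule ln_le_minus_one)
    also have "\<dots> \<le> t\<^sup>2 / 2 * expectation (\<lambda>x. (G x)\<^sup>2) + C * t ^ 3"
      using bound[of t] t by (simp add: mean abs_le_iff)
    finally show ?thesis .
  qed
  with C that show ?thesis
    by blast
qed

end

section \<open>Lower bounds for the difference of the exponents\<close>

text \<open>The larger exponent is bounded below by its value at one admissible pair, and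
  \<open>Lambda_star\<close> above by \<open>b\<close>. As \<open>b\<close> is real, the difference
  is never of the form infinity minus infinity.\<close>

lemma Delta_lower_bound:
  assumes "\<epsilon> > 0"
    and star: "\<And>t. 0 \<le> t \<Longrightarrow>
          t * \<epsilon> - ln (prob_space.expectation M (\<lambda>\<omega>. exp (t * F (X \<omega>)))) \<le> b"
    and plus: "ln (prob_space.expectation M (\<lambda>\<omega>. exp (\<epsilon> * (F (X \<omega>) - \<gamma> * U (X \<omega>))))) \<le> a"
  shows "ereal (\<epsilon>\<^sup>2 - \<bar>\<gamma>\<bar> * \<epsilon> * u - a - b) \<le> Delta M X F U \<epsilon> u"
proof -
  have "ereal (\<epsilon>\<^sup>2 - \<bar>\<gamma>\<bar> * \<epsilon> * u - a)
      \<le> max (Lambda_plus_star M X F U \<epsilon> u) (Gamma_plus_star M X F U \<epsilon> u)"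
  proof (cases "\<gamma> \<ge> 0")
    case True
    have "ereal (\<epsilon>\<^sup>2 - \<bar>\<gamma>\<bar> * \<epsilon> * u - a) \<le> Lambda_plus_star M X F U \<epsilon> u"
      unfolding Lambda_plus_star_def
      by (rule SUP_upper2[of "(\<epsilon>, \<gamma> * \<epsilon>)"])
         (use True assms(1) plus in \<open>auto simp: power2_eq_square algebra_simps\<close>)
    thus ?thesis
      by (simp add: le_max_iff_disj)
  next
    case False
    have "ereal (\<epsilon>\<^sup>2 - \<bar>\<gamma>\<bar> * \<epsilon> * u - a) \<le> Gamma_plus_star M X F U \<epsilon> u"
      unfolding Gamma_plus_star_def
      \<comment> \<open>The second coordinate is again
        \<open>\<bar>\<gamma>\<bar> * \<epsilon>\<close>, and the plus sign in
        \<open>Gamma_plus_star\<close> restores the exponent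
        \<open>\<epsilon> * (F - \<gamma> * U)\<close>.\<close>
      by (rule SUP_upper2[of "(\<epsilon>, - \<gamma> * \<epsilon>)"])
         (use False assms(1) plus in
           \<open>auto simp: power2_eq_square algebra_simps mult_nonneg_nonpos\<close>)
    thus ?thesis
      by (simp add: le_max_iff_disj)
  qed
  moreover have "Lambda_star M X F \<epsilon> \<le> ereal b"
    unfolding Lambda_star_def log_mgf_def using star by (intro SUP_least) auto
  ultimately show ?thesis
    unfolding Delta_def ereal_minus(1)[symmetric] by (rule ereal_minus_mono)
qed

text \<open>Since \<open>U\<close> has variance 1, \<open>\<gamma> * U\<close> is the best linear
  predictor of \<open>F\<close> from \<open>U\<close>, and the residual \<open>G\<close> has the
  least variance among all \<open>F - a * U\<close>, namely \<open>1 - \<gamma>\<^sup>2\<close>.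
  This reduction outweighs the cost of the constraint \<open>u\<close>.\<close>

lemma Delta_quadratic_lower_bound:
  fixes M :: "'a measure" and X :: "'a \<Rightarrow> real" and F U :: "real \<Rightarrow> real" and \<gamma> :: real
  assumes M: "prob_space M"
    and [measurable]: "X \<in> borel_measurable M"
      "F \<in> borel_measurable borel" "U \<in> borel_measurable borel"
    and intF: "\<And>\<theta>. integrable M (\<lambda>\<omega>. exp (\<theta> * F (X \<omega>)))"
    and intU: "\<And>\<theta>. integrable M (\<lambda>\<omega>. exp (\<theta> * U (X \<omega>)))"
    and EF: "prob_space.expectation M (\<lambda>\<omega>. F (X \<omega>)) = 0"
    and EU: "prob_space.expectation M (\<lambda>\<omega>. U (X \<omega>)) = 0"
    and VF: "prob_space.variance M (\<lambda>\<omega>. F (X \<omega>)) = 1"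
    and VU: "prob_space.variance M (\<lambda>\<omega>. U (X \<omega>)) = 1"
    and \<gamma>: "\<gamma> = covariance M (\<lambda>\<omega>. F (X \<omega>)) (\<lambda>\<omega>. U (X \<omega>))" "\<gamma> \<noteq> 0"
  obtains \<epsilon>\<^sub>0 where "\<epsilon>\<^sub>0 > 0"
    and "\<And>\<epsilon>. 0 < \<epsilon> \<Longrightarrow> \<epsilon> < \<epsilon>\<^sub>0 \<Longrightarrow>
           Delta M X F U \<epsilon> (\<bar>\<gamma>\<bar> / 4 * \<epsilon>) \<ge> ereal (\<gamma>\<^sup>2 / 8 * \<epsilon>\<^sup>2)"
proof -
  interpret prob_space M by (rule M)
  let ?F = "\<lambda>\<omega>. F (X \<omega>)" and ?U = "\<lambda>\<omega>. U (X \<omega>)"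
  define G where "G = (\<lambda>\<omega>. ?F \<omega> - \<gamma> * ?U \<omega>)"
  have mF: "?F \<in> borel_measurable M" and mU: "?U \<in> borel_measurable M"
    and mG: "G \<in> borel_measurable M"
    unfolding G_def by measurable
  have F1: "integrable M ?F" and F2: "integrable M (\<lambda>\<omega>. (?F \<omega>)\<^sup>2)"
    and U1: "integrable M ?U" and U2: "integrable M (\<lambda>\<omega>. (?U \<omega>)\<^sup>2)"
    using integrable_power_of_mgf[OF mF intF, of 1] integrable_power_of_mgf[OF mF intF, of 2]
      integrable_power_of_mgf[OF mU intU, of 1] integrable_power_of_mgf[OF mU intU, of 2] by auto
  have intG: "integrable M (\<lambda>\<omega>. exp (t * G \<omega>))" for t
    using integrable_exp_add[of "\<lambda>\<omega>. t * ?F \<omega>" "\<lambda>\<omega>. - (t * \<gamma>) * ?U \<omega>"]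
      intF[of "2 * t"] intU[of "2 * - (t * \<gamma>)"]
    by (simp add: G_def algebra_simps)
  have EF2: "expectation (\<lambda>\<omega>. (?F \<omega>)\<^sup>2) = 1" and EU2: "expectation (\<lambda>\<omega>. (?U \<omega>)\<^sup>2) = 1"
    and EFU: "expectation (\<lambda>\<omega>. ?F \<omega> * ?U \<omega>) = \<gamma>"
    using VF VU \<gamma>(1) by (simp_all add: EF EU covariance_def)
  \<comment> \<open>The integral of a non-integrable function is 0 by convention, which
    \<open>\<gamma> \<noteq> 0\<close> rules out.\<close>
  have FU: "integrable M (\<lambda>\<omega>. ?F \<omega> * ?U \<omega>)"
    by (rule ccontr) (use EFU \<gamma>(2) in \<open>auto simp: not_integrable_integral_eq\<close>)
  have EG: "expectation G = 0"
    unfolding G_def using F1 U1 by (simp add: EF EU)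
  have "(\<lambda>\<omega>. (G \<omega>)\<^sup>2) = (\<lambda>\<omega>. (?F \<omega>)\<^sup>2 - 2 * \<gamma> * (?F \<omega> * ?U \<omega>) + \<gamma>\<^sup>2 * (?U \<omega>)\<^sup>2)"
    by (auto simp: G_def power2_eq_square algebra_simps)
  hence EG2: "expectation (\<lambda>\<omega>. (G \<omega>)\<^sup>2) = 1 - \<gamma>\<^sup>2"
    using F2 U2 FU by (simp add: EF2 EU2 EFU) (simp add: power2_eq_square)
  obtain C where C: "C \<ge> 0"
    and upper: "\<And>t. 0 \<le> t \<Longrightarrow> t \<le> 1 \<Longrightarrow>
      ln (expectation (\<lambda>\<omega>. exp (t * G \<omega>))) \<le> t\<^sup>2 / 2 * (1 - \<gamma>\<^sup>2) + C * t ^ 3"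
    using log_mgf_quadratic_upper_bound[OF mG intG EG] unfolding EG2 by blast
  have g: "\<gamma>\<^sup>2 > 0"
    using \<gamma>(2) by simp
  \<comment> \<open>Chosen so that \<open>\<epsilon>\<^sup>2 / (2 * c)\<close> exceeds
    \<open>\<epsilon>\<^sup>2 / 2\<close> by exactly
    \<open>\<gamma>\<^sup>2 / 16 * \<epsilon>\<^sup>2\<close>.\<close>
  define c where "c = 1 / (1 + \<gamma>\<^sup>2 / 8)"
  have c: "0 < c" "c < 1"
    using g by (auto simp: c_def field_simps add_pos_pos)
  obtain e where e: "e > 0"
    and star: "\<And>\<epsilon> t. 0 < \<epsilon> \<Longrightarrow> \<epsilon> < e \<Longrightarrow> 0 \<le> t \<Longrightarrow>
      t * \<epsilon> - ln (expectation (\<lambda>\<omega>. exp (t * ?F \<omega>))) \<le> \<epsilon>\<^sup>2 / (2 * c)"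
    using legendre_quadratic_upper_bound[OF mF intF EF EF2 c] by blast
  \<comment> \<open>The last bound keeps the cubic error below
    \<open>\<gamma>\<^sup>2 / 16 * \<epsilon>\<^sup>2\<close>; \<open>C + 1\<close> avoids division
    by 0.\<close>
  define \<epsilon>\<^sub>0 where "\<epsilon>\<^sub>0 = min (min 1 e) (\<gamma>\<^sup>2 / (16 * (C + 1)))"
  have "\<epsilon>\<^sub>0 > 0"
    using e g C by (simp add: \<epsilon>\<^sub>0_def)
  moreover have "Delta M X F U \<epsilon> (\<bar>\<gamma>\<bar> / 4 * \<epsilon>) \<ge> ereal (\<gamma>\<^sup>2 / 8 * \<epsilon>\<^sup>2)"
    if \<epsilon>: "0 < \<epsilon>" "\<epsilon> < \<epsilon>\<^sub>0" for \<epsilon>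
  proof -
    have "\<epsilon> * (16 * (C + 1)) \<le> \<gamma>\<^sup>2"
      using \<epsilon> C by (simp add: \<epsilon>\<^sub>0_def pos_less_divide_eq less_imp_le)
    hence "C * \<epsilon> \<le> \<gamma>\<^sup>2 / 16"
      using \<epsilon> by (simp add: algebra_simps)
    hence "C * \<epsilon> * \<epsilon>\<^sup>2 \<le> \<gamma>\<^sup>2 / 16 * \<epsilon>\<^sup>2"
      by (rule mult_right_mono) simp
    hence C\<epsilon>: "C * \<epsilon> ^ 3 \<le> \<gamma>\<^sup>2 / 16 * \<epsilon>\<^sup>2"
      by (simp add: power2_eq_square power3_eq_cube mult.assoc)
    have gg: "\<bar>\<gamma>\<bar> * \<epsilon> * (\<bar>\<gamma>\<bar> / 4 * \<epsilon>) = \<gamma>\<^sup>2 / 4 * \<epsilon>\<^sup>2"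
      by (simp add: power2_eq_square)
    have "\<epsilon>\<^sup>2 / (2 * c) = \<epsilon>\<^sup>2 / 2 + \<gamma>\<^sup>2 / 16 * \<epsilon>\<^sup>2"
      by (simp add: c_def algebra_simps)
    \<comment> \<open>In units of \<open>\<gamma>\<^sup>2 * \<epsilon>\<^sup>2\<close>, the variance
      reduction gains 1/2, \<open>u\<close> costs 1/4, and \<open>c\<close> and the cubic error cost
      at most 1/16 each, leaving 1/8.\<close>
    hence "\<gamma>\<^sup>2 / 8 * \<epsilon>\<^sup>2 \<le> \<epsilon>\<^sup>2 - \<bar>\<gamma>\<bar> * \<epsilon> * (\<bar>\<gamma>\<bar> / 4 * \<epsilon>)
        - (\<epsilon>\<^sup>2 / 2 * (1 - \<gamma>\<^sup>2) + C * \<epsilon> ^ 3) - \<epsilon>\<^sup>2 / (2 * c)"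
      unfolding gg using C\<epsilon> by (simp add: algebra_simps diff_divide_distrib)
    moreover have "ereal (\<epsilon>\<^sup>2 - \<bar>\<gamma>\<bar> * \<epsilon> * (\<bar>\<gamma>\<bar> / 4 * \<epsilon>)
        - (\<epsilon>\<^sup>2 / 2 * (1 - \<gamma>\<^sup>2) + C * \<epsilon> ^ 3) - \<epsilon>\<^sup>2 / (2 * c)) \<le> Delta M X F U \<epsilon> (\<bar>\<gamma>\<bar> / 4 * \<epsilon>)"
      using \<epsilon> star[of \<epsilon>] upper[of \<epsilon>] by (intro Delta_lower_bound) (auto simp: \<epsilon>\<^sub>0_def G_def)
    ultimately show ?thesis
      by (meson ereal_less_eq(3) order_trans)
  qed
  ultimately show ?thesis
    using that by blast
qed

theorem theorem4p2:
  fixes M :: "'a measure" and X :: "'a \<Rightarrow> real" and F U :: "real \<Rightarrow> real" and \<gamma> :: real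
  assumes "prob_space M"
    and "X \<in> borel_measurable M"
    and "F \<in> borel_measurable borel" and "U \<in> borel_measurable borel"
    and "\<And>\<theta>. integrable M (\<lambda>\<omega>. exp (\<theta> * F (X \<omega>)))"
    and "\<And>\<theta>. integrable M (\<lambda>\<omega>. exp (\<theta> * U (X \<omega>)))"
    and "prob_space.expectation M (\<lambda>\<omega>. F (X \<omega>)) = 0"
    and "prob_space.expectation M (\<lambda>\<omega>. U (X \<omega>)) = 0"
    and "prob_space.variance M (\<lambda>\<omega>. F (X \<omega>)) = 1"
    and "prob_space.variance M (\<lambda>\<omega>. U (X \<omega>)) = 1"
    and "\<gamma> = covariance M (\<lambda>\<omega>. F (X \<omega>)) (\<lambda>\<omega>. U (X \<omega>))"
    and "\<gamma> \<noteq> 0"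
  shows "(\<exists>\<alpha>>0. Liminf (at_right 0) (\<lambda>\<epsilon>. ereal (1 / \<epsilon>\<^sup>2) * Delta M X F U \<epsilon> (\<alpha> * \<epsilon>)) > 0) \<and>
    (\<exists>\<epsilon>\<^sub>0>0. \<forall>\<epsilon>\<in>{0<..<\<epsilon>\<^sub>0}.
       Delta M X F U \<epsilon> (\<bar>\<gamma>\<bar> / 4 * \<epsilon>) \<ge> ereal (\<gamma>\<^sup>2 / 8 * \<epsilon>\<^sup>2))"
proof -
  obtain \<epsilon>\<^sub>0 where \<epsilon>\<^sub>0: "\<epsilon>\<^sub>0 > 0"
    and Delta: "\<And>\<epsilon>. 0 < \<epsilon> \<Longrightarrow> \<epsilon> < \<epsilon>\<^sub>0 \<Longrightarrow>
      ereal (\<gamma>\<^sup>2 / 8 * \<epsilon>\<^sup>2) \<le> Delta M X F U \<epsilon> (\<bar>\<gamma>\<bar> / 4 * \<epsilon>)"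
    using Delta_quadratic_lower_bound[OF assms] by blast
  \<comment> \<open>The first claim follows from the second with
    \<open>\<alpha> = \<bar>\<gamma>\<bar> / 4\<close>: division by
    \<open>\<epsilon>\<^sup>2\<close> turns the quadratic bound into a positive constant, which
    passes to \<open>Liminf\<close>.\<close>
  have "\<forall>\<^sub>F \<epsilon> in at_right 0.
      ereal (\<gamma>\<^sup>2 / 8) \<le> ereal (1 / \<epsilon>\<^sup>2) * Delta M X F U \<epsilon> (\<bar>\<gamma>\<bar> / 4 * \<epsilon>)"
    using eventually_at_right_less[of 0] order_tendstoD(2)[OF tendsto_ident_at \<epsilon>\<^sub>0]
  proof eventually_elim
    case (elim \<epsilon>)
    have "ereal (\<gamma>\<^sup>2 / 8) = ereal (1 / \<epsilon>\<^sup>2) * ereal (\<gamma>\<^sup>2 / 8 * \<epsilon>\<^sup>2)"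
      using elim by simp
    also have "\<dots> \<le> ereal (1 / \<epsilon>\<^sup>2) * Delta M X F U \<epsilon> (\<bar>\<gamma>\<bar> / 4 * \<epsilon>)"
      using Delta[of \<epsilon>] elim by (intro ereal_mult_left_mono) auto
    finally show ?case .
  qed
  hence "ereal (\<gamma>\<^sup>2 / 8)
      \<le> Liminf (at_right 0) (\<lambda>\<epsilon>. ereal (1 / \<epsilon>\<^sup>2) * Delta M X F U \<epsilon> (\<bar>\<gamma>\<bar> / 4 * \<epsilon>))"
    by (rule Liminf_bounded)
  moreover have "0 < ereal (\<gamma>\<^sup>2 / 8)" "0 < \<bar>\<gamma>\<bar> / 4"
    using \<open>\<gamma> \<noteq> 0\<close> by auto
  ultimately have
    "\<exists>\<alpha>>0. Liminf (at_right 0) (\<lambda>\<epsilon>. ereal (1 / \<epsilon>\<^sup>2) * Delta M X F U \<epsilon> (\<alpha> * \<epsilon>)) > 0"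
    by (meson less_le_trans)
  with \<epsilon>\<^sub>0 Delta show ?thesis
    by auto
qed

end
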